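(* Let $\mathcal{L}_0(s,p)$ be a given duality-invariant theory. Then the one-parameter family of theories $$\mathcal{M}_\gamma(\mathcal{L}_0)(s,p)=\mathcal{L}_0\big(\mathcal{L}^{\mathrm{MM}}_\gamma(s,p),\,p\big),\qquad \gamma\in\mathbb{R},$$ is duality-invariant, where $$\mathcal{L}^{\mathrm{MM}}_\gamma(s,p)=\cosh\gamma\; s+\sinh\gamma\,\sqrt{s^2+p^2}$$ is the ModMax Lagrangian.
   Context: A theory of (non-linear) electrodynamics on four-dimensional flat space-time is given by a Lagrangian $\mathcal{L}=\mathcal{L}(s,p)$, a function of the two invariants $s=-\frac14F_{ab}F^{ab}$ and $p=-\frac14F_{ab}(\star F)^{ab}$ of the field strength $F_{ab}=2\partial_{[a}A_{b]}$, where $(\star F)_{ab}=\frac12\varepsilon_{abcd}F^{cd}$. The theory is duality-invariant if it satisfies $$p\left(\frac{\partial\mathcal{L}}{\partial s}\right)^2-2s\,\frac{\partial\mathcal{L}}{\partial s}\frac{\partial\mathcal{L}}{\partial p}-p\left(\frac{\partial\mathcal{L}}{\partial p}\right)^2+\psi=p$$ for some term $\psi$ that is independent of $F_{ab}$ ($\psi$ is not required to vanish). The map $\mathcal{M}_\gamma$, called the ModMax map, replaces every appearance of $s$ in $\mathcal{L}_0$ by $\mathcal{L}^{\mathrm{MM}}_\gamma(s,p)$.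
   Formalization: For γ ≠ 0 the duality condition is asserted only away from s = p = 0, since the ModMax Lagrangian has no partial derivative in s there (already for L₀ = s); theories are taken differentiable on an open region of the (s,p)-plane. *)

theory Defs
  imports "HOL-Analysis.Analysis"
begin

text \<open>
  Flat space-time has the index type \<open>4\<close>, with time index \<open>0\<close> (the same element as \<open>4 :: 4\<close>) and
  spatial indices \<open>1, 2, 3\<close>; the metric has signature \<open>(-, +, +, +)\<close>.
  A value of the field strength is a matrix of covariant components \<open>F\<^sub>a\<^sub>b\<close>.
\<close>

definition minkowski :: "real ^ 4 ^ 4" where
  "minkowski = (\<chi> a b. if a \<noteq> b then 0 else if a = 0 then -1 else 1)"

text \<open>
  Covariant components, normalised by \<open>\<epsilon>\<^sub>1\<^sub>2\<^sub>3\<^sub>0 = 1\<close>, that is \<open>\<epsilon>\<^sub>0\<^sub>1\<^sub>2\<^sub>3 = -1\<close>. With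
  \<open>E\<^sub>i = F\<^sub>i\<^sub>0\<close> this convention gives \<open>s = (E\<^sup>2 - B\<^sup>2) / 2\<close> and \<open>p = E \<cdot> B\<close>.
\<close>

definition levi_civita :: "4 \<Rightarrow> 4 \<Rightarrow> 4 \<Rightarrow> 4 \<Rightarrow> real" where
  "levi_civita a b c d =
     det ((\<chi> i. axis (if i = 1 then a else if i = 2 then b else if i = 3 then c else d) 1) :: real ^ 4 ^ 4)"

text \<open>\<open>minkowski\<close> is its own inverse, so it also raises indices.\<close>

definition raise :: "real ^ 4 ^ 4 \<Rightarrow> real ^ 4 ^ 4" where
  "raise F = minkowski ** F ** minkowski"

definition hodge :: "real ^ 4 ^ 4 \<Rightarrow> real ^ 4 ^ 4" where
  "hodge F = (\<chi> a b. 1 / 2 * (\<Sum>c\<in>UNIV. \<Sum>d\<in>UNIV. levi_civita a b c d * raise F $ c $ d))"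

definition field_strength :: "real ^ 4 ^ 4 \<Rightarrow> bool" where
  "field_strength F \<longleftrightarrow> transpose F = - F"

definition inv_s :: "real ^ 4 ^ 4 \<Rightarrow> real" where
  "inv_s F = - (1 / 4) * (\<Sum>a\<in>UNIV. \<Sum>b\<in>UNIV. F $ a $ b * raise F $ a $ b)"

definition inv_p :: "real ^ 4 ^ 4 \<Rightarrow> real" where
  "inv_p F = - (1 / 4) * (\<Sum>a\<in>UNIV. \<Sum>b\<in>UNIV. F $ a $ b * raise (hodge F) $ a $ b)"

text \<open>
  A theory is a Lagrangian \<open>L s p\<close> together with the open region \<open>D\<close> of the \<open>(s, p)\<close>-plane on which
  it is considered (Born--Infeld, for example, is not defined on the whole plane).
\<close>

definition duality_invariant :: "(real \<times> real) set \<Rightarrow> (real \<Rightarrow> real \<Rightarrow> real) \<Rightarrow> bool" where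
  "duality_invariant D L \<longleftrightarrow>
     open D \<and> (\<lambda>(s, p). L s p) differentiable_on D \<and>
     (\<exists>\<psi>. \<forall>F. field_strength F \<and> (inv_s F, inv_p F) \<in> D \<longrightarrow>
        (let s = inv_s F; p = inv_p F;
             Ls = deriv (\<lambda>x. L x p) s; Lp = deriv (\<lambda>y. L s y) p
         in p * Ls\<^sup>2 - 2 * s * Ls * Lp - p * Lp\<^sup>2 + \<psi> = p))"

definition modmax_lagrangian :: "real \<Rightarrow> real \<Rightarrow> real \<Rightarrow> real" where
  "modmax_lagrangian \<gamma> s p = cosh \<gamma> * s + sinh \<gamma> * sqrt (s\<^sup>2 + p\<^sup>2)"

definition modmax_map :: "real \<Rightarrow> (real \<Rightarrow> real \<Rightarrow> real) \<Rightarrow> real \<Rightarrow> real \<Rightarrow> real" where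
  "modmax_map \<gamma> L s p = L (modmax_lagrangian \<gamma> s p) p"

text \<open>
  The transformed theory lives where the substituted arguments lie in \<open>D\<close>. For \<open>\<gamma> \<noteq> 0\<close> the origin
  is left out, because \<open>modmax_lagrangian \<gamma>\<close> is not differentiable there.
\<close>

definition modmax_domain :: "real \<Rightarrow> (real \<times> real) set \<Rightarrow> (real \<times> real) set" where
  "modmax_domain \<gamma> D =
     {(s, p). (modmax_lagrangian \<gamma> s p, p) \<in> D \<and> (\<gamma> = 0 \<or> (s, p) \<noteq> (0, 0))}"

end

theory Submission
  imports Defs
begin

text \<open>
  Write \<open>r = sqrt (s\<^sup>2 + p\<^sup>2)\<close>, \<open>S = cosh \<gamma> * s + sinh \<gamma> * r\<close> and \<open>R = cosh \<gamma> * r + sinh \<gamma> * s\<close>.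
  The pair \<open>(s, r)\<close> is boosted to \<open>(S, R)\<close>, and \<open>\<partial>S/\<partial>s = R / r\<close>, \<open>\<partial>S/\<partial>p = sinh \<gamma> * p / r\<close>.
  Inserting the chain rule, the duality condition of the transformed theory at \<open>(s, p)\<close> becomes that
  of the original one at \<open>(S, p)\<close>, with the same \<open>\<psi>\<close>. The original condition is only
  known at values of the invariants, so one also needs every point \<open>(S, p)\<close> to be attained by
  some field strength: parallel fields \<open>E\<close> and \<open>B\<close> with \<open>(E + \<i> B)\<^sup>2 = 2 (S + \<i> p)\<close> do that.
\<close>

section \<open>Attaining the invariants\<close>

lemma raise_nth:
  "raise F $ a $ b = (if a = 0 then -1 else 1) * (if b = 0 then -1 else 1) * F $ a $ b"
proof -
  \<comment> \<open>Testing for the diagonal first lets \<open>sum.delta\<close> collapse both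
    matrix products.\<close>
  have *: "minkowski = (\<chi> a b. if a = b then (if a = 0 then -1 else 1) else 0)"
    by (auto simp: minkowski_def vec_eq_iff)
  show ?thesis
    unfolding raise_def * matrix_matrix_mult_def
    by (simp add: if_distrib[of "\<lambda>x. x * _"] if_distrib[of "\<lambda>x. _ * x"] sum.delta sum.delta'
        cong: if_cong)
qed

text \<open>Permuting the indices permutes the rows of the defining determinant. Writing the indices
  as values of \<open>f\<close> turns this into composition with \<open>\<pi>\<close>.\<close>

lemma levi_civita_permute:
  assumes "\<pi> permutes (UNIV :: 4 set)"
  shows "levi_civita (f (\<pi> 1)) (f (\<pi> 2)) (f (\<pi> 3)) (f (\<pi> 4)) =
    of_int (sign \<pi>) * levi_civita (f 1) (f 2) (f 3) (f 4)"
proof -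
  have *: "levi_civita (g 1) (g 2) (g 3) (g 4) = det ((\<chi> i. axis (g i) 1) :: real ^ 4 ^ 4)"
    for g :: "4 \<Rightarrow> 4"
  proof -
    have "(if i = 1 then g 1 else if i = 2 then g 2 else if i = 3 then g 3 else g 4) = g i" for i
      using exhaust_4[of i] by auto
    then show ?thesis
      by (simp only: levi_civita_def)
  qed
  show ?thesis
    using det_permute_rows[OF assms, of "(\<chi> i. axis (f i) 1) :: real ^ 4 ^ 4"]
      *[of f] *[of "\<lambda>i. f (\<pi> i)"]
    by simp
qed

lemma levi_civita_swap:
  "levi_civita b a c d = - levi_civita a b c d"
  "levi_civita a c b d = - levi_civita a b c d"
  "levi_civita a b d c = - levi_civita a b c d"
proof -
  define f where "f = (\<lambda>i :: 4. if i = 1 then a else if i = 2 then b else if i = 3 then c else d)"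
  have "f 1 = a" "f 2 = b" "f 3 = c" "f 4 = d"
    by (simp_all add: f_def)
  moreover have "Transposition.transpose i j permutes (UNIV :: 4 set)" for i j
    by (simp add: permutes_swap_id)
  ultimately show
    "levi_civita b a c d = - levi_civita a b c d"
    "levi_civita a c b d = - levi_civita a b c d"
    "levi_civita a b d c = - levi_civita a b c d"
    using levi_civita_permute[of "Transposition.transpose 1 2" f]
      levi_civita_permute[of "Transposition.transpose 2 3" f]
      levi_civita_permute[of "Transposition.transpose 3 4" f]
    by (simp_all add: sign_swap_id permutes_swap_id Transposition.transpose_def)
qed

lemma levi_civita_repeat:
  "levi_civita a a c d = 0" "levi_civita a b c c = 0"
  using levi_civita_swap(1)[of a a c d] levi_civita_swap(3)[of a b c c] by simp_all

text \<open>Together with \<open>levi_civita_2301\<close> these are all the values that a field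
  coupling only 0 with 1 and 2 with 3 requires.\<close>

lemma levi_civita_repeat_pairs:
  "levi_civita a b a b = 0" "levi_civita a b b a = 0"
  using levi_civita_swap(2)[of a b a b] levi_civita_swap(3)[of a b a b]
  by (simp_all add: levi_civita_repeat)

lemma levi_civita_1230: "levi_civita 1 2 3 0 = 1"
proof -
  have "((\<chi> i. axis (if i = 1 then 1 else if i = 2 then 2 else if i = 3 then 3 else 0) 1) :: real ^ 4 ^ 4)
    = mat 1"
    (is "(\<chi> i. axis (?f i) 1) = _")
  proof -
    \<comment> \<open>The last index is written \<open>0\<close>, which is the same element as
      \<open>4\<close>.\<close>
    have "?f i = i" for i :: 4
      using exhaust_4[of i] by auto
    then show ?thesis
      by (simp add: vec_eq_iff axis_def mat_def)
  qed
  then show ?thesis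
    by (simp add: levi_civita_def)
qed

lemma levi_civita_2301:
  "levi_civita 2 3 0 1 = -1" "levi_civita 2 3 1 0 = 1" "levi_civita 3 2 0 1 = 1"
  "levi_civita 3 2 1 0 = -1" "levi_civita 0 1 2 3 = -1" "levi_civita 0 1 3 2 = 1"
  "levi_civita 1 0 2 3 = 1" "levi_civita 1 0 3 2 = -1"
proof -
  \<comment> \<open>Both base values lie two adjacent swaps away from 1230, hence are 1 as
    well.\<close>
  have a: "levi_civita 2 3 1 0 = 1"
    using levi_civita_1230 levi_civita_swap(1)[of 2 1 3 0] levi_civita_swap(2)[of 2 1 3 0] by simp
  have b: "levi_civita 1 0 2 3 = 1"
    using levi_civita_1230 levi_civita_swap(3)[of 1 2 0 3] levi_civita_swap(2)[of 1 2 0 3]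
    by simp
  show "levi_civita 2 3 0 1 = -1" "levi_civita 2 3 1 0 = 1" "levi_civita 3 2 0 1 = 1"
    "levi_civita 3 2 1 0 = -1" "levi_civita 0 1 2 3 = -1" "levi_civita 0 1 3 2 = 1"
    "levi_civita 1 0 2 3 = 1" "levi_civita 1 0 3 2 = -1"
    using a b levi_civita_swap(3)[of 2 3 1 0] levi_civita_swap(1)[of 2 3 0 1]
      levi_civita_swap(1)[of 2 3 1 0] levi_civita_swap(1)[of 1 0 2 3]
      levi_civita_swap(3)[of 0 1 2 3] levi_civita_swap(3)[of 1 0 2 3]
    by simp_all
qed

text \<open>E and B both point along the first axis: \<open>e\<close> is E_1 = F_10 and
  \<open>b\<close> is B_1 = F_23.\<close>

definition parallel_field :: "real \<Rightarrow> real \<Rightarrow> real ^ 4 ^ 4" where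
  "parallel_field e b = (\<chi> i j.
     if i = 1 \<and> j = 0 then e else if i = 0 \<and> j = 1 then - e
     else if i = 2 \<and> j = 3 then b else if i = 3 \<and> j = 2 then - b else 0)"

lemma field_strength_parallel_field: "field_strength (parallel_field e b)"
  by (auto simp: field_strength_def parallel_field_def vec_eq_iff Finite_Cartesian_Product.transpose_def)

lemma zero_eq_four: "(0 :: 4) = 4"
  by simp

text \<open>Names the indices as \<open>parallel_field_nth\<close> does, where \<open>sum_4\<close>
  would produce 4 in place of 0.\<close>

lemma sum_4': "sum f (UNIV :: 4 set) = f 0 + f 1 + f 2 + f 3"
  unfolding zero_eq_four sum_4 by (simp add: algebra_simps)

lemma parallel_field_nth:
  "parallel_field e b $ 0 $ 0 = 0" "parallel_field e b $ 0 $ 1 = - e"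
  "parallel_field e b $ 0 $ 2 = 0" "parallel_field e b $ 0 $ 3 = 0"
  "parallel_field e b $ 1 $ 0 = e" "parallel_field e b $ 1 $ 1 = 0"
  "parallel_field e b $ 1 $ 2 = 0" "parallel_field e b $ 1 $ 3 = 0"
  "parallel_field e b $ 2 $ 0 = 0" "parallel_field e b $ 2 $ 1 = 0"
  "parallel_field e b $ 2 $ 2 = 0" "parallel_field e b $ 2 $ 3 = b"
  "parallel_field e b $ 3 $ 0 = 0" "parallel_field e b $ 3 $ 1 = 0"
  "parallel_field e b $ 3 $ 2 = - b" "parallel_field e b $ 3 $ 3 = 0"
  by (simp_all add: parallel_field_def)

lemma inv_s_parallel_field: "inv_s (parallel_field e b) = (e\<^sup>2 - b\<^sup>2) / 2"
  by (simp add: inv_s_def raise_nth sum_4' parallel_field_nth power2_eq_square field_simps)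

text \<open>The Hodge dual exchanges the two blocks of the field, so each surviving term pairs one
  \<open>e\<close> with one \<open>b\<close>.\<close>

lemma inv_p_parallel_field: "inv_p (parallel_field e b) = e * b"
  by (simp add: inv_p_def raise_nth sum_4' parallel_field_nth hodge_def levi_civita_2301
      levi_civita_repeat_pairs field_simps)

lemma invariants_surj:
  obtains F where "field_strength F" "inv_s F = s" "inv_p F = p"
proof -
  \<comment> \<open>\<open>Re z\<close> and \<open>Im z\<close> become \<open>e\<close> and
    \<open>b\<close>: the square of e + i b has real part e^2 - b^2 and imaginary part 2 e
    b.\<close>
  define z where "z = csqrt (Complex (2 * s) (2 * p))"
  have "z\<^sup>2 = Complex (2 * s) (2 * p)"
    by (simp add: z_def)
  then have "(Re z)\<^sup>2 - (Im z)\<^sup>2 = 2 * s" "2 * Re z * Im z = 2 * p"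
    by (metis Re_power2 complex.sel(1), metis Im_power2 complex.sel(2))
  then show ?thesis
    using that[of "parallel_field (Re z) (Im z)"]
    by (simp add: field_strength_parallel_field inv_s_parallel_field inv_p_parallel_field)
qed

section \<open>The ModMax substitution\<close>

text \<open>Here \<open>a\<close> and \<open>b\<close> stand for the partial derivatives, which
  separates the algebra from the calculus.\<close>

definition duality_term :: "real \<Rightarrow> real \<Rightarrow> real \<Rightarrow> real \<Rightarrow> real" where
  "duality_term s p a b = p * a\<^sup>2 - 2 * s * a * b - p * b\<^sup>2"

text \<open>By \<open>invariants_surj\<close> every point of \<open>D\<close> comes from a field
  strength, so the quantifier over fields becomes one over \<open>D\<close>.\<close>

lemma duality_invariant_iff:
  "duality_invariant D L \<longleftrightarrow>
     open D \<and> (\<lambda>(s, p). L s p) differentiable_on D \<and>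
     (\<exists>\<psi>. \<forall>(s, p)\<in>D. duality_term s p (deriv (\<lambda>x. L x p) s) (deriv (\<lambda>y. L s y) p) + \<psi> = p)"
proof -
  have "(\<forall>F. field_strength F \<and> (inv_s F, inv_p F) \<in> D \<longrightarrow> P (inv_s F) (inv_p F)) \<longleftrightarrow>
      (\<forall>(s, p)\<in>D. P s p)" for P
  proof (intro iffI ballI)
    fix z
    assume P: "\<forall>F. field_strength F \<and> (inv_s F, inv_p F) \<in> D \<longrightarrow> P (inv_s F) (inv_p F)" and z: "z \<in> D"
    obtain F where "field_strength F" "inv_s F = fst z" "inv_p F = snd z"
      by (rule invariants_surj)
    with P z show "case z of (s, p) \<Rightarrow> P s p"
      by (metis case_prod_beta prod.collapse)
  qed auto
  \<comment> \<open>\<open>\<psi>\<close> stays schematic so that the equivalence can rewrite under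
    the existential quantifier.\<close>
  note * = this[of "\<lambda>s p. duality_term s p (deriv (\<lambda>x. L x p) s) (deriv (\<lambda>y. L s y) p) + \<psi> = p" for \<psi>]
  show ?thesis
    unfolding duality_invariant_def Let_def duality_term_def[symmetric] * ..
qed

text \<open>\<open>a\<close> and \<open>b\<close> are meant as the partials of the original
  Lagrangian at (S, p), the arguments on the left as those of the transformed one. The expression is
  linear in (s, p), so dividing by r reduces the claim to the unit circle.\<close>

lemma duality_term_modmax:
  fixes s p a b \<gamma> :: real
  assumes "(s, p) \<noteq> (0, 0)"
  defines "r \<equiv> sqrt (s\<^sup>2 + p\<^sup>2)"
  shows "duality_term s p (a * (cosh \<gamma> + sinh \<gamma> * s / r)) (a * (sinh \<gamma> * p / r) + b) =
    duality_term (modmax_lagrangian \<gamma> s p) p a b"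
proof -
  have r: "r > 0"
    using assms by (auto simp: sum_power2_gt_zero_iff)
  have r2: "r\<^sup>2 = s\<^sup>2 + p\<^sup>2"
    by (simp add: r_def)
  define x y where "x = s / r" and "y = p / r"
  have s: "s = r * x" and p: "p = r * y"
    using r by (simp_all add: x_def y_def)
  have xy: "x\<^sup>2 + y\<^sup>2 = 1"
    unfolding x_def y_def power_divide add_divide_distrib[symmetric] r2[symmetric] using r by simp
  have ch: "(cosh \<gamma>)\<^sup>2 - (sinh \<gamma>)\<^sup>2 = 1"
    by (rule hyperbolic_pythagoras)
  have S: "modmax_lagrangian \<gamma> s p = r * (cosh \<gamma> * x + sinh \<gamma>)"
    unfolding modmax_lagrangian_def x_def r_def[symmetric] using r by (simp add: field_simps)
  \<comment> \<open>Comparing coefficients: a^2 gives y (C^2 - H^2 (x^2 + y^2)) = y, a b gives -2 (C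
    x + H (x^2 + y^2)), and b^2 agrees as it stands.\<close>
  have "y * (a * (C + H * x))\<^sup>2 - 2 * x * (a * (C + H * x)) * (a * (H * y) + b) - y * (a * (H * y) + b)\<^sup>2 =
      y * a\<^sup>2 - 2 * (C * x + H) * a * b - y * b\<^sup>2"
    if "C\<^sup>2 - H\<^sup>2 = 1" for C H :: real
    using that xy by algebra
  from arg_cong[OF this[OF ch], of "\<lambda>t. r * t"] show ?thesis
    unfolding duality_term_def S times_divide_eq_right[symmetric] x_def[symmetric] y_def[symmetric]
    unfolding s p by (simp add: algebra_simps)
qed

lemma modmax_lagrangian_has_derivative:
  assumes "(s, p) \<noteq> (0, 0)"
  shows "((\<lambda>(s, p). modmax_lagrangian \<gamma> s p) has_derivative
    (\<lambda>(h, k). (cosh \<gamma> + sinh \<gamma> * s / sqrt (s\<^sup>2 + p\<^sup>2)) * h + (sinh \<gamma> * p / sqrt (s\<^sup>2 + p\<^sup>2)) * k))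
    (at (s, p))"
proof -
  define r where "r = sqrt (s\<^sup>2 + p\<^sup>2)"
  have pos: "s\<^sup>2 + p\<^sup>2 > 0"
    using assms by (auto simp: sum_power2_gt_zero_iff)
  then have r: "r > 0"
    by (simp add: r_def)
  from pos have *: "((\<lambda>z. cosh \<gamma> * fst z + sinh \<gamma> * sqrt ((fst z)\<^sup>2 + (snd z)\<^sup>2)) has_derivative
    (\<lambda>z. cosh \<gamma> * fst z + sinh \<gamma> * ((2 * fst z * s + 2 * snd z * p) * (inverse r / 2))))
    (at (s, p))"
    unfolding r_def
    by (auto intro!: derivative_eq_intros simp: fun_eq_iff algebra_simps)
  have "c * h + d * ((2 * h * s + 2 * k * p) * (inverse r / 2)) = (c + d * s / r) * h + (d * p / r) * k"
    for c d h k :: real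
    using r by (simp add: field_simps)
  with * show ?thesis
    unfolding modmax_lagrangian_def case_prod_beta r_def[symmetric]
    by simp
qed

text \<open>Chain rule along the horizontal and the vertical line through (s, p).\<close>

lemma deriv_partial:
  fixes f :: "real \<Rightarrow> real \<Rightarrow> real"
  assumes "((\<lambda>(s, p). f s p) has_derivative (\<lambda>(h, k). a * h + b * k)) (at (s, p))"
  shows "deriv (\<lambda>x. f x p) s = a" "deriv (\<lambda>y. f s y) p = b"
proof -
  have "((\<lambda>x. (x, p)) has_derivative (\<lambda>h. (h, 0))) (at s)"
    "((\<lambda>y. (s, y)) has_derivative (\<lambda>k. (0, k))) (at p)"
    by (auto intro!: derivative_eq_intros)
  from this[THEN has_derivative_compose, OF assms]
  have "((\<lambda>x. f x p) has_derivative (*) a) (at s)" "((\<lambda>y. f s y) has_derivative (*) b) (at p)"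
    by simp_all
  then show "deriv (\<lambda>x. f x p) s = a" "deriv (\<lambda>y. f s y) p = b"
    by (simp_all add: DERIV_imp_deriv has_field_derivative_def)
qed

text \<open>The duality condition speaks of partial derivatives, the chain rule of total ones. A
  linear map on the plane is fixed by its values on the two unit vectors.\<close>

lemma differentiable_partials:
  fixes f :: "real \<Rightarrow> real \<Rightarrow> real"
  assumes "(\<lambda>(s, p). f s p) differentiable (at (s, p))"
  shows "((\<lambda>(s, p). f s p) has_derivative
    (\<lambda>(h, k). deriv (\<lambda>x. f x p) s * h + deriv (\<lambda>y. f s y) p * k)) (at (s, p))"
proof -
  obtain f' where f': "((\<lambda>(s, p). f s p) has_derivative f') (at (s, p))"
    using assms by (auto simp: differentiable_def)
  interpret f': bounded_linear f'
    using f' by (rule has_derivative_bounded_linear)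
  have "f' (h, k) = f' (1, 0) * h + f' (0, 1) * k" for h k
  proof -
    have "(h, k) = h *\<^sub>R (1, 0) + k *\<^sub>R (0, 1)"
      by simp
    then show ?thesis
      by (metis f'.add f'.scaleR mult.commute real_scaleR_def)
  qed
  then have "f' = (\<lambda>(h, k). f' (1, 0) * h + f' (0, 1) * k)"
    by (intro ext) (metis case_prod_conv surj_pair)
  with f' have *: "((\<lambda>(s, p). f s p) has_derivative (\<lambda>(h, k). f' (1, 0) * h + f' (0, 1) * k)) (at (s, p))"
    by metis
  show ?thesis
    using * by (simp add: deriv_partial[OF *])
qed

text \<open>Chain rule for (s, p) \<mapsto> (S, p). The variable p enters both directly and through
  S, whence the summand \<open>b\<close>.\<close>

lemma modmax_map_has_derivative:
  assumes "((\<lambda>(s, p). L s p) has_derivative (\<lambda>(h, k). a * h + b * k))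
    (at (modmax_lagrangian \<gamma> s p, p))"
    and "(s, p) \<noteq> (0, 0)"
  shows "((\<lambda>(s, p). modmax_map \<gamma> L s p) has_derivative
    (\<lambda>(h, k). a * (cosh \<gamma> + sinh \<gamma> * s / sqrt (s\<^sup>2 + p\<^sup>2)) * h
      + (a * (sinh \<gamma> * p / sqrt (s\<^sup>2 + p\<^sup>2)) + b) * k)) (at (s, p))"
proof -
  have "((\<lambda>z. (case z of (s, p) \<Rightarrow> modmax_lagrangian \<gamma> s p, snd z)) has_derivative
    (\<lambda>z. (case z of (h, k) \<Rightarrow> (cosh \<gamma> + sinh \<gamma> * s / sqrt (s\<^sup>2 + p\<^sup>2)) * h
      + (sinh \<gamma> * p / sqrt (s\<^sup>2 + p\<^sup>2)) * k, snd z))) (at (s, p))"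
    by (intro has_derivative_Pair modmax_lagrangian_has_derivative[OF assms(2)]
        has_derivative_snd has_derivative_ident)
  from has_derivative_compose[OF this, of "\<lambda>(s, p). L s p" "\<lambda>(h, k). a * h + b * k"] assms(1)
  show ?thesis
    by (simp add: modmax_map_def case_prod_unfold algebra_simps)
qed

text \<open>The substitution is continuous even at the origin, so this is an open preimage with at
  most one point removed.\<close>

lemma open_modmax_domain:
  assumes "open D"
  shows "open (modmax_domain \<gamma> D)"
proof -
  have "modmax_domain \<gamma> D =
    (\<lambda>z. (modmax_lagrangian \<gamma> (fst z) (snd z), snd z)) -` D \<inter> (if \<gamma> = 0 then UNIV else - {(0, 0)})"
    by (auto simp: modmax_domain_def)
  moreover have "open ((\<lambda>z. (modmax_lagrangian \<gamma> (fst z) (snd z), snd z)) -` D)"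
    unfolding modmax_lagrangian_def
    by (intro open_vimage[OF assms] continuous_intros)
  ultimately show ?thesis
    by (auto intro!: open_Int)
qed

theorem theorem1:
  fixes L\<^sub>0 :: "real \<Rightarrow> real \<Rightarrow> real" and D :: "(real \<times> real) set" and \<gamma> :: real
  assumes "duality_invariant D L\<^sub>0"
  shows "duality_invariant (modmax_domain \<gamma> D) (modmax_map \<gamma> L\<^sub>0)"
proof (cases "\<gamma> = 0")
  \<comment> \<open>The origin may belong to the domain here, where the derivative lemmas do not
    apply, but the substitution is the identity.\<close>
  case True
  then have "modmax_domain \<gamma> D = D" "modmax_map \<gamma> L\<^sub>0 = L\<^sub>0"
    by (auto simp: modmax_domain_def modmax_map_def modmax_lagrangian_def fun_eq_iff)
  with assms show ?thesis
    by simp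
next
  case False
  obtain \<psi> where D: "open D" and diff: "(\<lambda>(s, p). L\<^sub>0 s p) differentiable_on D"
    and \<psi>: "\<And>s p. (s, p) \<in> D \<Longrightarrow>
      duality_term s p (deriv (\<lambda>x. L\<^sub>0 x p) s) (deriv (\<lambda>y. L\<^sub>0 s y) p) + \<psi> = p"
    using assms unfolding duality_invariant_iff by auto
  have modmax: "(\<lambda>(s, p). modmax_map \<gamma> L\<^sub>0 s p) differentiable (at (s, p))"
    "duality_term s p (deriv (\<lambda>x. modmax_map \<gamma> L\<^sub>0 x p) s) (deriv (\<lambda>y. modmax_map \<gamma> L\<^sub>0 s y) p) + \<psi> = p"
    if sp: "(s, p) \<in> modmax_domain \<gamma> D" for s p
  proof -
    have mem: "(modmax_lagrangian \<gamma> s p, p) \<in> D" and nz: "(s, p) \<noteq> (0, 0)"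
      using sp False by (auto simp: modmax_domain_def)
    have "(\<lambda>(s, p). L\<^sub>0 s p) differentiable (at (modmax_lagrangian \<gamma> s p, p))"
      using diff mem D by (simp add: differentiable_on_eq_differentiable_at)
    note deriv = modmax_map_has_derivative[OF differentiable_partials[OF this] nz]
    show "(\<lambda>(s, p). modmax_map \<gamma> L\<^sub>0 s p) differentiable (at (s, p))"
      using deriv by (rule differentiableI)
    show "duality_term s p (deriv (\<lambda>x. modmax_map \<gamma> L\<^sub>0 x p) s) (deriv (\<lambda>y. modmax_map \<gamma> L\<^sub>0 s y) p) + \<psi> = p"
      \<comment> \<open>Since p is left unchanged, the original condition at (S, p) has the required
        right-hand side.\<close>
      unfolding deriv_partial[OF deriv] duality_term_modmax[OF nz] by (rule \<psi>[OF mem])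
  qed
  show ?thesis
    unfolding duality_invariant_iff
  proof (intro conjI exI[of _ \<psi>])
    show "open (modmax_domain \<gamma> D)"
      by (rule open_modmax_domain[OF D])
    then show "(\<lambda>(s, p). modmax_map \<gamma> L\<^sub>0 s p) differentiable_on modmax_domain \<gamma> D"
      using modmax(1) by (auto simp: differentiable_on_eq_differentiable_at)
    show "\<forall>(s, p)\<in>modmax_domain \<gamma> D.
        duality_term s p (deriv (\<lambda>x. modmax_map \<gamma> L\<^sub>0 x p) s) (deriv (\<lambda>y. modmax_map \<gamma> L\<^sub>0 s y) p) + \<psi> = p"
      using modmax(2) by auto
  qed
qed

end
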